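(* Let $N\geq1$ be an integer, let $\mathfrak{g}=(\mathfrak{g},\ell)$ be any Lie $N$-algebra over a field $\mathbb{K}$ of characteristic $0$, and let $n$ be an integer with $n>2N$. Then every $n$-shifted Poisson structure on the Chevalley–Eilenberg algebra $\mathrm{CE}(\mathfrak{g})$ is trivial, i.e. equal to $0$.
   Context: **Conventions.** $\mathbb{K}$ is a field of characteristic $0$. Cochain complexes $V=(V^i,\mathrm{d})_{i\in\mathbb{Z}}$ have differentials of degree $+1$, with the usual tensor product and symmetric braiding $\gamma(v\otimes w)=(-1)^{|v||w|}w\otimes v$. $\underline{\mathrm{hom}}(V,W)^i=\prod_j\mathrm{Hom}(V^j,W^{j+i})$ with $\partial L=\mathrm{d}_WL-(-1)^{|L|}L\,\mathrm{d}_V$. The shift is $V[n]^i=V^{i+n}$, $\mathrm{d}_{V[n]}=(-1)^n\mathrm{d}_V$; elements of $V[n]$ are written $s^{-n}v$, where $s^{-n}$ has degree $-n$, and Koszul signs arise when moving $s$ past elements; in particular $Q\,(s^{-n-1}T)=(-1)^{|Q|(n+1)}s^{-n-1}(QT)$. **Lie $N$-algebras.** A Lie $N$-algebra is an $L_\infty$-algebra $(\mathfrak{g},\ell)$ whose underlying cochain complex $\mathfrak{g}=(\mathfrak{g}^{-N+1}\to\cdots\to\mathfrak{g}^{-1}\to\mathfrak{g}^0)$ consists of finite-dimensional vector spaces and is concentrated in degrees $-N+1,\dots,0$; the structure is a family $\ell=\{\ell_l\}_{l\geq2}$ of totally graded antisymmetric maps $\ell_l:\mathfrak{g}^{\otimes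 l}\to\mathfrak{g}$ of degree $2-l$ satisfying the homotopy Jacobi identities. Equivalently, with $\pi^{(1,l)}:=(-1)^{l-1}\ell_l$ for $l\geq 2$ and $\pi^{(1,0)}=\pi^{(1,1)}=0$, for all $l\geq 2$: $(-1)^{l-1}\partial\pi^{(1,l)}+\sum_{l_1+l_2-1=l}(-1)^{(2-l_1)(l_2-1)}\sum_{\sigma\in\mathrm{Sh}(l_1-1,l_2)}(-1)^{|\sigma|}\,\pi^{(1,l_1)}\circ(\mathrm{id}^{\otimes(l_1-1)}\otimes\pi^{(1,l_2)})\circ\gamma_\sigma=0$, where $\mathrm{Sh}(p,q)$ is the set of permutations increasing on $\{1,\dots,p\}$ and on $\{p+1,\dots,p+q\}$, $|\sigma|$ is the signature, and $\gamma_\sigma(y_1\otimes\cdots\otimes y_k)=\pm y_{\sigma(1)}\otimes\cdots\otimes y_{\sigma(k)}$ with Koszul sign. **Polyvectors and shifted Poisson structures.** For a commutative differential graded algebra (CDGA) $A$, $\mathbb{T}_A\subseteq\underline{\mathrm{hom}}(A,A)$ is the complex of derivations, $D(aa')=(Da)a'+(-1)^{|D||a|}a(Da')$, an $A$-dg-module via $(aD)(a')=a\,D(a')$, with Lie bracket $[D,D']=DD'-(-1)^{|D||D'|}D'D$. The CDGA of $n$-shifted polyvectors is $\mathrm{Pol}(A,n)=\mathrm{Sym}_A(\mathbb{T}_A[-n-1])=\bigoplus_{m\geq0}\mathrm{Sym}_A^m(\mathbb{T}_A[-n-1])$, where $m$ is called the weight; its completion is $\widehat{\mathrm{Pol}}(A,n)=\prod_{m\geq0}\mathrm{Sym}^m_A(\mathbb{T}_A[-n-1])$.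 The Schouten–Nijenhuis bracket $[\![\cdot,\cdot]\!]$ is the degree $0$ Lie bracket on $\mathrm{Pol}(A,n)[n+1]$ determined by $[\![s^{-n-1}a,s^{-n-1}a']\!]=0$, $[\![s^{-n-1}s^{n+1}D,s^{-n-1}a]\!]=(-1)^{|D|(n+1)}s^{-n-1}D(a)$, $[\![s^{-n-1}s^{n+1}D,s^{-n-1}s^{n+1}D']\!]=s^{-n-1}s^{n+1}[D,D']$, by (graded) antisymmetry, and by $[\![s^{-n-1}P,s^{-n-1}QR]\!]=[\![s^{-n-1}P,s^{-n-1}Q]\!]R+(-1)^{|P||Q|}Q[\![s^{-n-1}P,s^{-n-1}R]\!]$. It lowers total weight by $1$ and extends weight-wise to $\widehat{\mathrm{Pol}}(A,n)[n+1]$. An $n$-shifted Poisson structure on $A$ is an element $\pi=\sum_{m\geq2}\pi^{(m)}\in\widehat{\mathrm{Pol}}(A,n)^{n+2}$ of degree $n+2$ and weight $\geq2$ with $\partial(s^{-n-1}\pi)+\frac12[\![s^{-n-1}\pi,s^{-n-1}\pi]\!]=0$. **Chevalley–Eilenberg algebra.** Let $\mathfrak{g}^\ast=\underline{\mathrm{hom}}(\mathfrak{g},\mathbb{K})$ and $A=\mathrm{Sym}(\mathfrak{g}^\ast[-1])$. Then $\mathbb{T}_A\cong A\otimes\mathfrak{g}[1]$, where $s^{-1}x\in\mathfrak{g}[1]$ is the derivation with $s^{-1}x(s\theta)=\langle\theta,x\rangle$. $\mathrm{CE}(\mathfrak{g})$ is the CDGA with the same underlying graded commutative algebra as $A$ and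 differential $\mathrm{d}+\alpha$, where $\mathrm{d}$ is the differential of $A$ and $\alpha\in\mathbb{T}_A^1$ (satisfying $\partial\alpha+\frac12[\alpha,\alpha]=0$) is the derivation encoding the brackets: writing the weight $1$ polyvector $s^{n+1}\alpha$ as a linear combination of terms $s^nx\,s\theta_1\cdots s\theta_l$ (with $s^nx:=s^{n+1}s^{-1}x$), the linear isomorphism $s^nx\,s\theta_1\cdots s\theta_l\mapsto(-1)^{|x|l+\sum_j|\theta_j|(l-j)}s^{n+l}L$, with $L(y_1,\dots,y_l)=\sum_{\sigma\in S_l}(-1)^{|\theta_1\cdots\theta_l|^\sigma_-}(-1)^{|y_1\cdots y_l|^{\mathrm{rev}}_+}x\prod_j\langle\theta_{\sigma(j)},y_j\rangle$, sends $s^{n+1}\alpha$ to $\sum_{l\geq2}s^{n+l}(-1)^{l-1}\ell_l$ (this does not depend on $n$). Here $(-1)^{|v_1\cdots v_k|^\sigma_{\pm}}$ is the sign with $v_1\cdots v_k=(\text{sign})\,v_{\sigma(1)}\cdots v_{\sigma(k)}$ in the graded symmetric ($+$) or exterior ($-$) power, and $\mathrm{rev}$ is the order-reversing permutation. *)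

theory Defs
  imports
    "HOL-Algebra.QuotRing"
    "HOL-Algebra.Module"
    "HOL-Algebra.Algebraic_Closure_Type"
    "HOL-Library.Poly_Mapping"
    "HOL-Library.FuncSet"
    "HOL-Combinatorics.Permutations"
begin

section \<open>Cochain complexes, CDGAs and dg-modules\<close>

text \<open>
  The ground field is the type \<open>'k :: field_char_0\<close>. A graded object is the family of its
  homogeneous pieces, and degrees are always carried along explicitly: operations whose value
  or sign depends on the degree take that degree as an argument. The vector \<open>vzero V\<close>
  is the zero vector of every piece.
\<close>

record ('k, 'v) cochain =
  piece  :: "int \<Rightarrow> 'v set"
  vadd   :: "'v \<Rightarrow> 'v \<Rightarrow> 'v"
  vzero  :: 'v
  vscale :: "'k \<Rightarrow> 'v \<Rightarrow> 'v"
  vdiff  :: "int \<Rightarrow> 'v \<Rightarrow> 'v"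

record ('k, 'a) cdga = "('k, 'a) cochain" +
  amult :: "'a \<Rightarrow> 'a \<Rightarrow> 'a"
  aunit :: 'a

record ('k, 'a, 'm) dgmod = "('k, 'm) cochain" +
  act :: "int \<Rightarrow> 'a \<Rightarrow> 'm \<Rightarrow> 'm"

abbreviation eps :: "int \<Rightarrow> 'k::field" where
  "eps i \<equiv> (- 1) powi i"

definition piece_module :: "('k, 'v, 'z) cochain_scheme \<Rightarrow> int \<Rightarrow> ('k, 'v) module" where
  "piece_module V i =
     \<lparr>carrier = piece V i, monoid.mult = undefined, one = undefined,
      ring.zero = vzero V, ring.add = vadd V, module.smult = vscale V\<rparr>"

definition cochain_complex :: "('k::field_char_0, 'v, 'z) cochain_scheme \<Rightarrow> bool" where
  "cochain_complex V \<longleftrightarrow>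
     (\<forall>i. module (ring_of_type_algebra :: 'k ring) (piece_module V i)) \<and>
     (\<forall>i. \<forall>x\<in>piece V i. vdiff V i x \<in> piece V (i + 1)) \<and>
     (\<forall>i. \<forall>x\<in>piece V i. \<forall>y\<in>piece V i.
        vdiff V i (vadd V x y) = vadd V (vdiff V i x) (vdiff V i y)) \<and>
     (\<forall>i c. \<forall>x\<in>piece V i. vdiff V i (vscale V c x) = vscale V c (vdiff V i x)) \<and>
     (\<forall>i. \<forall>x\<in>piece V i. vdiff V (i + 1) (vdiff V i x) = vzero V)"

definition finite_dim_piece :: "('k, 'v, 'z) cochain_scheme \<Rightarrow> int \<Rightarrow> bool" where
  "finite_dim_piece V i \<longleftrightarrow>
     (\<exists>B. finite B \<and> B \<subseteq> piece V i \<and>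
        (\<forall>x\<in>piece V i. \<exists>c. x = finsum (piece_module V i) (\<lambda>b. vscale V (c b) b) B))"

text \<open>The underlying data of \<open>V[n]\<close> are those of \<open>V\<close>, so \<open>s\<^sup>-\<^sup>n\<close> is the identity on elements:
  \<open>s\<^sup>-\<^sup>nv\<close> is represented by \<open>v\<close>, now of degree \<open>|v| - n\<close>.
  The sign in the action is the Koszul sign for moving \<open>a\<close> past \<open>s\<^sup>-\<^sup>n\<close>.\<close>

definition shift :: "int \<Rightarrow> ('k::field, 'a, 'm) dgmod \<Rightarrow> ('k, 'a, 'm) dgmod" where
  "shift n M = M
     \<lparr>piece := (\<lambda>i. piece M (i + n)),
      vdiff := (\<lambda>i x. vscale M (eps n) (vdiff M (i + n) x)),
      act := (\<lambda>i a x. vscale M (eps (i * n)) (act M i a x))\<rparr>"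

definition ground_cdga :: "('k::field, 'k) cdga" where
  "ground_cdga =
     \<lparr>piece = (\<lambda>i. if i = 0 then UNIV else {0}), vadd = (+), vzero = 0, vscale = (*),
      vdiff = (\<lambda>_ _. 0), amult = (*), aunit = 1\<rparr>"

text \<open>An element of degree \<open>i\<close> of the complex of graded linear maps is a family
  \<open>j \<mapsto> (L j : V\<^sup>j \<rightarrow> W\<^sup>j\<^sup>+\<^sup>i)\<close>, each member being \<open>undefined\<close> off \<open>V\<^sup>j\<close>.\<close>

definition hom_piece ::
  "('k, 'v, 'y) cochain_scheme \<Rightarrow> ('k, 'w, 'z) cochain_scheme \<Rightarrow> int \<Rightarrow> (int \<Rightarrow> 'v \<Rightarrow> 'w) set" where
  "hom_piece V W i =
     {L. \<forall>j. L j \<in> piece V j \<rightarrow>\<^sub>E piece W (j + i) \<and>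
        (\<forall>x\<in>piece V j. \<forall>y\<in>piece V j. L j (vadd V x y) = vadd W (L j x) (L j y)) \<and>
        (\<forall>c. \<forall>x\<in>piece V j. L j (vscale V c x) = vscale W c (L j x))}"

definition hom_complex ::
  "('k::field, 'v, 'y) cochain_scheme \<Rightarrow> ('k, 'w, 'z) cochain_scheme \<Rightarrow>
     ('k, int \<Rightarrow> 'v \<Rightarrow> 'w) cochain" where
  "hom_complex V W =
     \<lparr>piece = hom_piece V W,
      vadd = (\<lambda>L L' j. \<lambda>x\<in>piece V j. vadd W (L j x) (L' j x)),
      vzero = (\<lambda>j. \<lambda>x\<in>piece V j. vzero W),
      vscale = (\<lambda>c L j. \<lambda>x\<in>piece V j. vscale W c (L j x)),
      vdiff = (\<lambda>i L j. \<lambda>x\<in>piece V j.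
        vadd W (vdiff W (j + i) (L j x)) (vscale W (- eps i) (L (j + 1) (vdiff V j x))))\<rparr>"

definition dual :: "('k::field, 'v, 'z) cochain_scheme \<Rightarrow> ('k, 'k, int \<Rightarrow> 'v \<Rightarrow> 'k) dgmod" where
  "dual V = cochain.extend (hom_complex V (ground_cdga :: ('k, 'k) cdga))
     (dgmod.fields (\<lambda>_. vscale (hom_complex V (ground_cdga :: ('k, 'k) cdga))))"


section \<open>Lie N-algebras\<close>

text \<open>A word is a list of homogeneous elements with their degrees, standing for a pure tensor.
  A linear map out of \<open>V\<^sup>\<otimes>\<^sup>l\<close> is given by its values on words of length \<open>l\<close>.\<close>

type_synonym 'v word = "(int \<times> 'v) list"

definition words :: "('k, 'v, 'z) cochain_scheme \<Rightarrow> nat \<Rightarrow> 'v word set" where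
  "words V l = {ys. length ys = l \<and> (\<forall>(i, y)\<in>set ys. y \<in> piece V i)}"

definition wdeg :: "'v word \<Rightarrow> int" where
  "wdeg ys = sum_list (map fst ys)"

text \<open>The sign in \<open>v\<^sub>1 \<cdots> v\<^sub>k = \<plusminus> v\<^sub>\<sigma>\<^sub>(\<^sub>1\<^sub>) \<cdots> v\<^sub>\<sigma>\<^sub>(\<^sub>k\<^sub>)\<close> for degrees \<open>ds\<close>:
  first in the graded symmetric, then in the graded exterior power. Positions count from \<open>0\<close>.\<close>

definition koszul_sign :: "int list \<Rightarrow> (nat \<Rightarrow> nat) \<Rightarrow> 'k::field" where
  "koszul_sign ds \<sigma> =
     (\<Prod>(i, j)\<in>{(i, j). i < j \<and> j < length ds \<and> \<sigma> j < \<sigma> i}. eps (ds ! \<sigma> i * ds ! \<sigma> j))"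

definition ext_sign :: "int list \<Rightarrow> (nat \<Rightarrow> nat) \<Rightarrow> 'k::field" where
  "ext_sign ds \<sigma> = of_int (sign \<sigma>) * koszul_sign ds \<sigma>"

definition multilinear ::
  "('k, 'v, 'z) cochain_scheme \<Rightarrow> nat \<Rightarrow> int \<Rightarrow> ('v word \<Rightarrow> 'v) \<Rightarrow> bool" where
  "multilinear V l k L \<longleftrightarrow>
     (\<forall>ys\<in>words V l. L ys \<in> piece V (wdeg ys + k)) \<and>
     (\<forall>us vs i. \<forall>x\<in>piece V i. \<forall>y\<in>piece V i. us @ [(i, x)] @ vs \<in> words V l \<longrightarrow>
        L (us @ [(i, vadd V x y)] @ vs) =
        vadd V (L (us @ [(i, x)] @ vs)) (L (us @ [(i, y)] @ vs))) \<and>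
     (\<forall>us vs i c. \<forall>x\<in>piece V i. us @ [(i, x)] @ vs \<in> words V l \<longrightarrow>
        L (us @ [(i, vscale V c x)] @ vs) = vscale V c (L (us @ [(i, x)] @ vs)))"

definition graded_antisymmetric ::
  "('k::field, 'v, 'z) cochain_scheme \<Rightarrow> nat \<Rightarrow> ('v word \<Rightarrow> 'v) \<Rightarrow> bool" where
  "graded_antisymmetric V l L \<longleftrightarrow>
     (\<forall>\<sigma> ys. \<sigma> permutes {..<l} \<longrightarrow> ys \<in> words V l \<longrightarrow>
        L ys = vscale V (ext_sign (map fst ys) \<sigma>) (L (permute_list \<sigma> ys)))"

text \<open>\<open>(\<partial>L)(ys)\<close> for \<open>L : V\<^sup>\<otimes>\<^sup>l \<rightarrow> V\<close> of degree \<open>k\<close>.\<close>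

definition multi_diff ::
  "('k::field, 'v, 'z) cochain_scheme \<Rightarrow> int \<Rightarrow> ('v word \<Rightarrow> 'v) \<Rightarrow> 'v word \<Rightarrow> 'v" where
  "multi_diff V k L ys =
     vadd V (vdiff V (wdeg ys + k) (L ys))
       (vscale V (- eps k)
         (finsum (piece_module V (wdeg ys + k + 1))
           (\<lambda>j. vscale V (eps (wdeg (take j ys)))
              (L (ys[j := (fst (ys ! j) + 1, vdiff V (fst (ys ! j)) (snd (ys ! j)))])))
           {..<length ys}))"

definition shuffles_perm :: "nat \<Rightarrow> nat \<Rightarrow> (nat \<Rightarrow> nat) set" where
  "shuffles_perm p q =
     {\<sigma>. \<sigma> permutes {..<p + q} \<and> strict_mono_on {..<p} \<sigma> \<and> strict_mono_on {p..<p + q} \<sigma>}"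

definition pi1 ::
  "('k::field, 'v, 'z) cochain_scheme \<Rightarrow> (nat \<Rightarrow> 'v word \<Rightarrow> 'v) \<Rightarrow> nat \<Rightarrow> 'v word \<Rightarrow> 'v" where
  "pi1 g lb l ys = (if l < 2 then vzero g else vscale g (eps (int l - 1)) (lb l ys))"

text \<open>\<open>L\<^sub>1 \<circ> (id\<^sup>\<otimes>\<^sup>p \<otimes> L\<^sub>2)\<close> with \<open>L\<^sub>2\<close> of degree \<open>k\<^sub>2\<close>; the sign comes from moving \<open>L\<^sub>2\<close> past the
  first \<open>p\<close> arguments.\<close>

definition insert_last ::
  "('k::field, 'v, 'z) cochain_scheme \<Rightarrow> nat \<Rightarrow> int \<Rightarrow>
     ('v word \<Rightarrow> 'v) \<Rightarrow> ('v word \<Rightarrow> 'v) \<Rightarrow> 'v word \<Rightarrow> 'v" where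
  "insert_last V p k\<^sub>2 L\<^sub>1 L\<^sub>2 zs =
     vscale V (eps (k\<^sub>2 * wdeg (take p zs)))
       (L\<^sub>1 (take p zs @ [(wdeg (drop p zs) + k\<^sub>2, L\<^sub>2 (drop p zs))]))"

definition homotopy_jacobi ::
  "('k::field, 'v, 'z) cochain_scheme \<Rightarrow> (nat \<Rightarrow> 'v word \<Rightarrow> 'v) \<Rightarrow> nat \<Rightarrow> bool" where
  "homotopy_jacobi g lb l \<longleftrightarrow>
     (\<forall>ys\<in>words g l.
        let P = piece_module g (wdeg ys + 3 - int l) in
        vadd g
          (vscale g (eps (int l - 1)) (multi_diff g (2 - int l) (pi1 g lb l) ys))
          (finsum P
            (\<lambda>(l\<^sub>1, l\<^sub>2). vscale g (eps ((2 - int l\<^sub>1) * (int l\<^sub>2 - 1)))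
               (finsum P
                 (\<lambda>\<sigma>. vscale g (of_int (sign \<sigma>) * koszul_sign (map fst ys) \<sigma>)
                    (insert_last g (l\<^sub>1 - 1) (2 - int l\<^sub>2) (pi1 g lb l\<^sub>1) (pi1 g lb l\<^sub>2)
                      (permute_list \<sigma> ys)))
                 (shuffles_perm (l\<^sub>1 - 1) l\<^sub>2)))
            {(l\<^sub>1, l\<^sub>2). 1 \<le> l\<^sub>1 \<and> l\<^sub>1 + l\<^sub>2 = l + 1})
        = vzero g)"

definition lie_N_algebra ::
  "nat \<Rightarrow> ('k::field_char_0, 'v) cochain \<Rightarrow> (nat \<Rightarrow> 'v word \<Rightarrow> 'v) \<Rightarrow> bool" where
  "lie_N_algebra N g lb \<longleftrightarrow>
     cochain_complex g \<and>
     (\<forall>i. finite_dim_piece g i) \<and>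
     (\<forall>i. i \<notin> {- int N + 1..0} \<longrightarrow> piece g i = {vzero g}) \<and>
     (\<forall>l\<ge>2. multilinear g l (2 - int l) (lb l)) \<and>
     (\<forall>l\<ge>2. graded_antisymmetric g l (lb l)) \<and>
     (\<forall>l\<ge>2. homotopy_jacobi g lb l)"


section \<open>Symmetric algebras over a CDGA\<close>

text \<open>
  \<open>Sym\<^sub>A(M)\<close> is the quotient of the free associative \<open>'k\<close>-algebra on the homogeneous elements of
  \<open>A\<close> (letters \<open>Coef\<close>) and of \<open>M\<close> (letters \<open>Gen\<close>) by the two-sided ideal that makes letters
  linear, identifies products \<open>a b\<close> and \<open>a m\<close> of letters with the product in \<open>A\<close> and the action on
  \<open>M\<close>, identifies the two units, and imposes graded commutativity.
\<close>

datatype ('a, 'm) letter = Coef int 'a | is_Gen: Gen int 'm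

type_synonym ('a, 'm, 'k) fsum = "('a, 'm) letter list \<Rightarrow>\<^sub>0 'k"

fun ldeg :: "('a, 'm) letter \<Rightarrow> int" where
  "ldeg (Coef i a) = i"
| "ldeg (Gen i m) = i"

definition lwdeg :: "('a, 'm) letter list \<Rightarrow> int" where
  "lwdeg w = sum_list (map ldeg w)"

definition weight :: "('a, 'm) letter list \<Rightarrow> nat" where
  "weight w = length (filter is_Gen w)"

definition fmono :: "('a, 'm) letter list \<Rightarrow> ('a, 'm, 'k::field) fsum" where
  "fmono w = Poly_Mapping.single w 1"

definition fscale :: "'k::field \<Rightarrow> ('a, 'm, 'k) fsum \<Rightarrow> ('a, 'm, 'k) fsum" where
  "fscale c f = Poly_Mapping.map ((*) c) f"

definition fmult ::
  "('a, 'm, 'k::field) fsum \<Rightarrow> ('a, 'm, 'k) fsum \<Rightarrow> ('a, 'm, 'k) fsum" where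
  "fmult f h =
     (\<Sum>u\<in>Poly_Mapping.keys f. \<Sum>v\<in>Poly_Mapping.keys h.
        Poly_Mapping.single (u @ v) (Poly_Mapping.lookup f u * Poly_Mapping.lookup h v))"

definition flinear ::
  "(('a, 'm) letter list \<Rightarrow> ('a, 'm, 'k::field) fsum) \<Rightarrow> ('a, 'm, 'k) fsum \<Rightarrow> ('a, 'm, 'k) fsum" where
  "flinear F f = (\<Sum>w\<in>Poly_Mapping.keys f. fscale (Poly_Mapping.lookup f w) (F w))"

definition letters ::
  "('k, 'a, 'y) cdga_scheme \<Rightarrow> ('k, 'a, 'm, 'z) dgmod_scheme \<Rightarrow> ('a, 'm) letter set" where
  "letters A M = {Coef i a |i a. a \<in> piece A i} \<union> {Gen i m |i m. m \<in> piece M i}"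

definition free_alg ::
  "('k::field, 'a, 'y) cdga_scheme \<Rightarrow> ('k, 'a, 'm, 'z) dgmod_scheme \<Rightarrow> ('a, 'm, 'k) fsum ring" where
  "free_alg A M =
     \<lparr>carrier = {f. Poly_Mapping.keys f \<subseteq> lists (letters A M)}, monoid.mult = fmult,
      one = fmono [], ring.zero = 0, ring.add = (+)\<rparr>"

inductive_set sym_rels ::
  "('k::field, 'a, 'y) cdga_scheme \<Rightarrow> ('k, 'a, 'm, 'z) dgmod_scheme \<Rightarrow> ('a, 'm, 'k) fsum set"
  for A :: "('k::field, 'a, 'y) cdga_scheme" and M :: "('k, 'a, 'm, 'z) dgmod_scheme" where
  Coef_add: "a \<in> piece A i \<Longrightarrow> b \<in> piece A i \<Longrightarrow>
     fmono [Coef i (vadd A a b)] - (fmono [Coef i a] + fmono [Coef i b]) \<in> sym_rels A M"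
| Coef_scale: "a \<in> piece A i \<Longrightarrow>
     fmono [Coef i (vscale A c a)] - fscale c (fmono [Coef i a]) \<in> sym_rels A M"
| Gen_add: "x \<in> piece M i \<Longrightarrow> y \<in> piece M i \<Longrightarrow>
     fmono [Gen i (vadd M x y)] - (fmono [Gen i x] + fmono [Gen i y]) \<in> sym_rels A M"
| Gen_scale: "x \<in> piece M i \<Longrightarrow>
     fmono [Gen i (vscale M c x)] - fscale c (fmono [Gen i x]) \<in> sym_rels A M"
| unit: "fmono [Coef 0 (aunit A)] - fmono [] \<in> sym_rels A M"
| mult: "a \<in> piece A i \<Longrightarrow> b \<in> piece A j \<Longrightarrow>
     fmono [Coef i a, Coef j b] - fmono [Coef (i + j) (amult A a b)] \<in> sym_rels A M"
| act: "a \<in> piece A i \<Longrightarrow> x \<in> piece M j \<Longrightarrow>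
     fmono [Coef i a, Gen j x] - fmono [Gen (i + j) (act M i a x)] \<in> sym_rels A M"
| comm: "p \<in> letters A M \<Longrightarrow> q \<in> letters A M \<Longrightarrow>
     fmono [p, q] - fscale (eps (ldeg p * ldeg q)) (fmono [q, p]) \<in> sym_rels A M"

definition sym_ideal ::
  "('k::field, 'a, 'y) cdga_scheme \<Rightarrow> ('k, 'a, 'm, 'z) dgmod_scheme \<Rightarrow> ('a, 'm, 'k) fsum set" where
  "sym_ideal A M = genideal (free_alg A M) (sym_rels A M)"

definition sym_ring ::
  "('k::field, 'a, 'y) cdga_scheme \<Rightarrow> ('k, 'a, 'm, 'z) dgmod_scheme \<Rightarrow>
     ('a, 'm, 'k) fsum set ring" where
  "sym_ring A M = free_alg A M Quot sym_ideal A M"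

definition cls ::
  "('k::field, 'a, 'y) cdga_scheme \<Rightarrow> ('k, 'a, 'm, 'z) dgmod_scheme \<Rightarrow>
     ('a, 'm, 'k) fsum \<Rightarrow> ('a, 'm, 'k) fsum set" where
  "cls A M f = sym_ideal A M +>\<^bsub>free_alg A M\<^esub> f"

text \<open>Operations on classes are induced from formal sums, as \<open>rcoset_mult\<close> is: the union runs over
  equal cosets whenever the operation respects the ideal.\<close>

definition lift_op ::
  "('k::field, 'a, 'y) cdga_scheme \<Rightarrow> ('k, 'a, 'm, 'z) dgmod_scheme \<Rightarrow>
     (('a, 'm, 'k) fsum \<Rightarrow> ('a, 'm, 'k) fsum) \<Rightarrow>
     ('a, 'm, 'k) fsum set \<Rightarrow> ('a, 'm, 'k) fsum set" where
  "lift_op A M F S = (\<Union>f\<in>S. cls A M (F f))"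

definition lift_op2 ::
  "('k::field, 'a, 'y) cdga_scheme \<Rightarrow> ('k, 'a, 'm, 'z) dgmod_scheme \<Rightarrow>
     (('a, 'm, 'k) fsum \<Rightarrow> ('a, 'm, 'k) fsum \<Rightarrow> ('a, 'm, 'k) fsum) \<Rightarrow>
     ('a, 'm, 'k) fsum set \<Rightarrow> ('a, 'm, 'k) fsum set \<Rightarrow> ('a, 'm, 'k) fsum set" where
  "lift_op2 A M F S T = (\<Union>f\<in>S. \<Union>h\<in>T. cls A M (F f h))"

fun letter_diff ::
  "('k, 'a, 'y) cdga_scheme \<Rightarrow> ('k, 'a, 'm, 'z) dgmod_scheme \<Rightarrow>
     ('a, 'm) letter \<Rightarrow> ('a, 'm) letter" where
  "letter_diff A M (Coef i a) = Coef (i + 1) (vdiff A i a)"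
| "letter_diff A M (Gen i x) = Gen (i + 1) (vdiff M i x)"

fun word_diff ::
  "('k::field, 'a, 'y) cdga_scheme \<Rightarrow> ('k, 'a, 'm, 'z) dgmod_scheme \<Rightarrow>
     ('a, 'm) letter list \<Rightarrow> ('a, 'm, 'k) fsum" where
  "word_diff A M [] = 0"
| "word_diff A M (p # w) =
     fmono (letter_diff A M p # w) +
     fscale (eps (ldeg p)) (fmult (fmono [p]) (word_diff A M w))"

definition sym_piece ::
  "('k::field, 'a, 'y) cdga_scheme \<Rightarrow> ('k, 'a, 'm, 'z) dgmod_scheme \<Rightarrow> nat \<Rightarrow> int \<Rightarrow>
     ('a, 'm, 'k) fsum set set" where
  "sym_piece A M m i =
     {cls A M f |f. f \<in> carrier (free_alg A M) \<and>
        (\<forall>w\<in>Poly_Mapping.keys f. lwdeg w = i \<and> weight w = m)}"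

definition Sym ::
  "('k::field, 'a, 'y) cdga_scheme \<Rightarrow> ('k, 'a, 'm, 'z) dgmod_scheme \<Rightarrow>
     ('k, ('a, 'm, 'k) fsum set) cdga" where
  "Sym A M =
     \<lparr>piece = (\<lambda>i. {cls A M f |f. f \<in> carrier (free_alg A M) \<and>
        (\<forall>w\<in>Poly_Mapping.keys f. lwdeg w = i)}),
      vadd = ring.add (sym_ring A M),
      vzero = ring.zero (sym_ring A M),
      vscale = (\<lambda>c. lift_op A M (fscale c)),
      vdiff = (\<lambda>i. lift_op A M (flinear (word_diff A M))),
      amult = monoid.mult (sym_ring A M),
      aunit = one (sym_ring A M)\<rparr>"


section \<open>Polyvectors and shifted Poisson structures\<close>

definition derivations ::
  "('k::field, 'a, 'y) cdga_scheme \<Rightarrow> int \<Rightarrow> (int \<Rightarrow> 'a \<Rightarrow> 'a) set" where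
  "derivations A k =
     {D\<in>hom_piece A A k. \<forall>i j. \<forall>a\<in>piece A i. \<forall>b\<in>piece A j.
        D (i + j) (amult A a b) =
        vadd A (amult A (D i a) b) (vscale A (eps (k * i)) (amult A a (D j b)))}"

definition tangent ::
  "('k::field, 'a, 'y) cdga_scheme \<Rightarrow> ('k, 'a, int \<Rightarrow> 'a \<Rightarrow> 'a) dgmod" where
  "tangent A =
     cochain.extend ((hom_complex A A)\<lparr>piece := derivations A\<rparr>)
       (dgmod.fields (\<lambda>_ a D j. \<lambda>b\<in>piece A j. amult A a (D j b)))"

definition der_bracket ::
  "('k::field, 'a, 'y) cdga_scheme \<Rightarrow> int \<Rightarrow> int \<Rightarrow>
     (int \<Rightarrow> 'a \<Rightarrow> 'a) \<Rightarrow> (int \<Rightarrow> 'a \<Rightarrow> 'a) \<Rightarrow> (int \<Rightarrow> 'a \<Rightarrow> 'a)" where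
  "der_bracket A p q D D' = (\<lambda>j. \<lambda>b\<in>piece A j.
     vadd A (D (j + q) (D' j b)) (vscale A (- eps (p * q)) (D' (j + p) (D j b))))"

definition Pol ::
  "('k::field, 'a, 'y) cdga_scheme \<Rightarrow> int \<Rightarrow>
     ('k, ('a, int \<Rightarrow> 'a \<Rightarrow> 'a, 'k) fsum set) cdga" where
  "Pol A n = Sym A (shift (- n - 1) (tangent A))"

text \<open>
  \<open>\<lbrakk>s\<^sup>-\<^sup>n\<^sup>-\<^sup>1P, s\<^sup>-\<^sup>n\<^sup>-\<^sup>1Q\<rbrakk> = s\<^sup>-\<^sup>n\<^sup>-\<^sup>1 b(P, Q)\<close> defines a bilinear \<open>b\<close> of degree \<open>- n - 1\<close> on \<open>Pol A n\<close>,
  and the Schouten-Nijenhuis bracket is described by \<open>b\<close>. In terms of \<open>b\<close>,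
  graded antisymmetry is \<open>b(P, Q) = - (-1)\<^bsup>(|P| - n - 1)(|Q| - n - 1)\<^esup> b(Q, P)\<close>.
  Since \<open>Q (s\<^sup>-\<^sup>n\<^sup>-\<^sup>1T) = (-1)\<^bsup>|Q|(n + 1)\<^esup> s\<^sup>-\<^sup>n\<^sup>-\<^sup>1(Q T)\<close>, the Leibniz rule becomes
  \<open>b(P, Q R) = b(P, Q) R + (-1)\<^bsup>(|P| + n + 1)|Q|\<^esup> Q b(P, R)\<close>; in particular \<open>b(P, 1) = 0\<close>.
  A letter \<open>Gen i D\<close> is \<open>s\<^sup>n\<^sup>+\<^sup>1D\<close> with \<open>D\<close> a derivation of degree \<open>i - n - 1\<close>.
  On pairs of words \<open>b\<close> is computed from letters by repeated use of the Leibniz rule in the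
  second argument and of antisymmetry.
\<close>

fun letter_bracket ::
  "('k::field, 'a, 'y) cdga_scheme \<Rightarrow> int \<Rightarrow>
     ('a, int \<Rightarrow> 'a \<Rightarrow> 'a) letter \<Rightarrow> ('a, int \<Rightarrow> 'a \<Rightarrow> 'a) letter \<Rightarrow>
     ('a, int \<Rightarrow> 'a \<Rightarrow> 'a, 'k) fsum" where
  "letter_bracket A n (Coef i a) (Coef j b) = 0"
| "letter_bracket A n (Gen i D) (Coef j b) =
     fscale (eps ((i - n - 1) * (n + 1))) (fmono [Coef (i + j - n - 1) (D j b)])"
| "letter_bracket A n (Coef i a) (Gen j D) =
     fscale (- eps ((i - n - 1) * (j - n - 1)))
       (fscale (eps ((j - n - 1) * (n + 1))) (fmono [Coef (j + i - n - 1) (D i a)]))"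
| "letter_bracket A n (Gen i D) (Gen j D') =
     fmono [Gen (i + j - n - 1) (der_bracket A (i - n - 1) (j - n - 1) D D')]"

fun letter_word_bracket ::
  "('k::field, 'a, 'y) cdga_scheme \<Rightarrow> int \<Rightarrow>
     ('a, int \<Rightarrow> 'a \<Rightarrow> 'a) letter \<Rightarrow> ('a, int \<Rightarrow> 'a \<Rightarrow> 'a) letter list \<Rightarrow>
     ('a, int \<Rightarrow> 'a \<Rightarrow> 'a, 'k) fsum" where
  "letter_word_bracket A n p [] = 0"
| "letter_word_bracket A n p (q # w) =
     fmult (letter_bracket A n p q) (fmono w) +
     fscale (eps ((ldeg p + n + 1) * ldeg q)) (fmult (fmono [q]) (letter_word_bracket A n p w))"

definition word_letter_bracket ::
  "('k::field, 'a, 'y) cdga_scheme \<Rightarrow> int \<Rightarrow>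
     ('a, int \<Rightarrow> 'a \<Rightarrow> 'a) letter list \<Rightarrow> ('a, int \<Rightarrow> 'a \<Rightarrow> 'a) letter \<Rightarrow>
     ('a, int \<Rightarrow> 'a \<Rightarrow> 'a, 'k) fsum" where
  "word_letter_bracket A n w q =
     fscale (- eps ((lwdeg w - n - 1) * (ldeg q - n - 1))) (letter_word_bracket A n q w)"

fun word_bracket ::
  "('k::field, 'a, 'y) cdga_scheme \<Rightarrow> int \<Rightarrow>
     ('a, int \<Rightarrow> 'a \<Rightarrow> 'a) letter list \<Rightarrow> ('a, int \<Rightarrow> 'a \<Rightarrow> 'a) letter list \<Rightarrow>
     ('a, int \<Rightarrow> 'a \<Rightarrow> 'a, 'k) fsum" where
  "word_bracket A n w [] = 0"
| "word_bracket A n w (q # v) =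
     fmult (word_letter_bracket A n w q) (fmono v) +
     fscale (eps ((lwdeg w + n + 1) * ldeg q)) (fmult (fmono [q]) (word_bracket A n w v))"

definition schouten ::
  "('k::field, 'a, 'y) cdga_scheme \<Rightarrow> int \<Rightarrow>
     ('a, int \<Rightarrow> 'a \<Rightarrow> 'a, 'k) fsum set \<Rightarrow> ('a, int \<Rightarrow> 'a \<Rightarrow> 'a, 'k) fsum set \<Rightarrow>
     ('a, int \<Rightarrow> 'a \<Rightarrow> 'a, 'k) fsum set" where
  "schouten A n = lift_op2 A (shift (- n - 1) (tangent A))
     (\<lambda>f h. flinear (\<lambda>w. flinear (\<lambda>v. word_bracket A n w v) h) f)"

text \<open>An element of the completion is the family of its weight components. Stripping \<open>s\<^sup>-\<^sup>n\<^sup>-\<^sup>1\<close> from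
  the weight \<open>m\<close> part of the Maurer-Cartan equation leaves
  \<open>(-1)\<^bsup>n + 1\<^esup> \<partial>\<pi>\<^bsup>(m)\<^esup> + 1/2 \<Sum> b(\<pi>\<^bsup>(p)\<^esup>, \<pi>\<^bsup>(q)\<^esup>) = 0\<close>, summed over \<open>p + q = m + 1\<close>.\<close>

definition completed_Pol_piece ::
  "('k::field, 'a, 'y) cdga_scheme \<Rightarrow> int \<Rightarrow> int \<Rightarrow>
     (nat \<Rightarrow> ('a, int \<Rightarrow> 'a \<Rightarrow> 'a, 'k) fsum set) set" where
  "completed_Pol_piece A n i =
     {\<pi>. \<forall>m. \<pi> m \<in> sym_piece A (shift (- n - 1) (tangent A)) m i}"

definition completed_Pol_zero ::
  "('k::field, 'a, 'y) cdga_scheme \<Rightarrow> int \<Rightarrow>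
     nat \<Rightarrow> ('a, int \<Rightarrow> 'a \<Rightarrow> 'a, 'k) fsum set" where
  "completed_Pol_zero A n = (\<lambda>m. vzero (Pol A n))"

definition shifted_poisson ::
  "('k::field_char_0, 'a, 'y) cdga_scheme \<Rightarrow> int \<Rightarrow>
     (nat \<Rightarrow> ('a, int \<Rightarrow> 'a \<Rightarrow> 'a, 'k) fsum set) \<Rightarrow> bool" where
  "shifted_poisson A n \<pi> \<longleftrightarrow>
     \<pi> \<in> completed_Pol_piece A n (n + 2) \<and>
     (\<forall>m<2. \<pi> m = vzero (Pol A n)) \<and>
     (\<forall>m.
        vadd (Pol A n)
          (vscale (Pol A n) (eps (n + 1)) (vdiff (Pol A n) (n + 2) (\<pi> m)))
          (vscale (Pol A n) (1 / 2)
            (finsum (sym_ring A (shift (- n - 1) (tangent A)))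
              (\<lambda>(p, q). schouten A n (\<pi> p) (\<pi> q)) {(p, q). p + q = m + 1}))
        = vzero (Pol A n))"


section \<open>The Chevalley-Eilenberg algebra\<close>

type_synonym ('v, 'k) ce = "('k, int \<Rightarrow> 'v \<Rightarrow> 'k, 'k) fsum set"

definition dual_shift :: "('k::field, 'v) cochain \<Rightarrow> ('k, 'k, int \<Rightarrow> 'v \<Rightarrow> 'k) dgmod" where
  "dual_shift g = shift (- 1) (dual g)"

definition sym_dual :: "('k::field, 'v) cochain \<Rightarrow> ('k, ('v, 'k) ce) cdga" where
  "sym_dual g = Sym (ground_cdga :: ('k, 'k) cdga) (dual_shift g)"

text \<open>The class of \<open>s\<theta>\<^sub>1 \<cdots> s\<theta>\<^sub>l\<close> for a list of functionals \<open>\<theta>\<^sub>j\<close> with their degrees in \<open>g\<^sup>*\<close>.\<close>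

definition ce_monom ::
  "('k::field, 'v) cochain \<Rightarrow> (int \<Rightarrow> 'v \<Rightarrow> 'k) word \<Rightarrow> ('v, 'k) ce" where
  "ce_monom g \<theta>s =
     cls (ground_cdga :: ('k, 'k) cdga) (dual_shift g) (fmono (map (\<lambda>(p, \<theta>). Gen (p + 1) \<theta>) \<theta>s))"

text \<open>The derivation \<open>s\<^sup>-\<^sup>1x\<close> for \<open>x\<close> of degree \<open>q\<close>. The pairing \<open>\<langle>\<theta>, x\<rangle>\<close> is \<open>\<theta> q x\<close>, which is
  automatically \<open>0\<close> unless \<open>|\<theta>| = - q\<close>.\<close>

definition contraction ::
  "('k::field, 'v) cochain \<Rightarrow> int \<Rightarrow> 'v \<Rightarrow> (int \<Rightarrow> ('v, 'k) ce \<Rightarrow> ('v, 'k) ce)" where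
  "contraction g q x =
     (THE D. D \<in> derivations (sym_dual g) (q - 1) \<and>
        (\<forall>p. \<forall>\<theta>\<in>piece (dual g) p.
           D (p + 1) (ce_monom g [(p, \<theta>)]) = vscale (sym_dual g) (\<theta> q x) (aunit (sym_dual g))))"

text \<open>A term \<open>(c, (q, x), \<theta>s)\<close> stands for \<open>c s\<^sup>nx s\<theta>\<^sub>1 \<cdots> s\<theta>\<^sub>l\<close> with \<open>|x| = q\<close>. In the graded
  commutative algebra of polyvectors,
  \<open>s\<^sup>nx s\<theta>\<^sub>1 \<cdots> s\<theta>\<^sub>l = s\<^sup>n\<^sup>+\<^sup>1((-1)\<^bsup>(q - 1)|s\<theta>\<^sub>1 \<cdots> s\<theta>\<^sub>l|\<^esup> s\<theta>\<^sub>1 \<cdots> s\<theta>\<^sub>l \<cdot> s\<^sup>-\<^sup>1x)\<close>, because the sign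
  for commuting \<open>s\<^sup>n\<^sup>+\<^sup>1s\<^sup>-\<^sup>1x\<close> with the coefficient and the sign for moving the coefficient past
  \<open>s\<^sup>n\<^sup>+\<^sup>1\<close> combine. So the derivation given by a term does not involve \<open>n\<close>.\<close>

type_synonym ('v, 'k) ce_term = "'k \<times> (int \<times> 'v) \<times> (int \<Rightarrow> 'v \<Rightarrow> 'k) word"

definition ce_terms :: "('k::field, 'v) cochain \<Rightarrow> int \<Rightarrow> ('v, 'k) ce_term set" where
  "ce_terms g k =
     {(c, (q, x), \<theta>s). x \<in> piece g q \<and> \<theta>s \<in> words (dual g) (length \<theta>s) \<and>
        (q - 1) + (wdeg \<theta>s + int (length \<theta>s)) = k}"

fun term_der ::
  "('k::field, 'v) cochain \<Rightarrow> ('v, 'k) ce_term \<Rightarrow> (int \<Rightarrow> ('v, 'k) ce \<Rightarrow> ('v, 'k) ce)" where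
  "term_der g (c, (q, x), \<theta>s) =
     vscale (tangent (sym_dual g)) (c * eps ((q - 1) * (wdeg \<theta>s + int (length \<theta>s))))
       (act (tangent (sym_dual g)) (wdeg \<theta>s + int (length \<theta>s)) (ce_monom g \<theta>s)
         (contraction g q x))"

text \<open>The multilinear map \<open>\<plusminus>c L\<close> attached to a term, including the sign
  \<open>(-1)\<^bsup>|x| l + \<Sum>\<^sub>j |\<theta>\<^sub>j| (l - j)\<^esup>\<close>, evaluated on \<open>ys\<close>; positions count from \<open>0\<close>.\<close>

fun term_map :: "('k::field, 'v) cochain \<Rightarrow> ('v, 'k) ce_term \<Rightarrow> 'v word \<Rightarrow> 'v" where
  "term_map g (c, (q, x), \<theta>s) ys =
     (let l = length \<theta>s in
      vscale g
        (c * eps (q * int l + (\<Sum>j<l. fst (\<theta>s ! j) * int (l - 1 - j))) *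
         (\<Sum>\<sigma> | \<sigma> permutes {..<l}.
            ext_sign (map fst \<theta>s) \<sigma> *
            koszul_sign (map fst ys) (\<lambda>i. if i < l then l - 1 - i else i) *
            (\<Prod>j<l. snd (\<theta>s ! \<sigma> j) (fst (ys ! j)) (snd (ys ! j)))))
        x)"

definition encodes_brackets ::
  "('k::field, 'v) cochain \<Rightarrow> (nat \<Rightarrow> 'v word \<Rightarrow> 'v) \<Rightarrow>
     (int \<Rightarrow> ('v, 'k) ce \<Rightarrow> ('v, 'k) ce) \<Rightarrow> bool" where
  "encodes_brackets g lb \<alpha> \<longleftrightarrow>
     (\<exists>ts. set ts \<subseteq> ce_terms g 1 \<and>
        \<alpha> = foldr (vadd (tangent (sym_dual g))) (map (term_der g) ts)
              (vzero (tangent (sym_dual g))) \<and>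
        (\<forall>l. \<forall>ys\<in>words g l.
           foldr (vadd g) (map (\<lambda>t. term_map g t ys) (filter (\<lambda>(c, x, \<theta>s). length \<theta>s = l) ts))
             (vzero g)
           = (if 2 \<le> l then vscale g (eps (int l - 1)) (lb l ys) else vzero g)))"

definition ce_twist ::
  "('k::field, 'v) cochain \<Rightarrow> (nat \<Rightarrow> 'v word \<Rightarrow> 'v) \<Rightarrow>
     (int \<Rightarrow> ('v, 'k) ce \<Rightarrow> ('v, 'k) ce)" where
  "ce_twist g lb =
     (THE \<alpha>. \<alpha> \<in> derivations (sym_dual g) 1 \<and> encodes_brackets g lb \<alpha>)"

definition CE ::
  "('k::field, 'v) cochain \<Rightarrow> (nat \<Rightarrow> 'v word \<Rightarrow> 'v) \<Rightarrow> ('k, ('v, 'k) ce) cdga" where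
  "CE g lb = (sym_dual g)
     \<lparr>vdiff := (\<lambda>i a. vadd (sym_dual g) (vdiff (sym_dual g) i a) (ce_twist g lb i a))\<rparr>"

end

theory Submission
  imports Defs
begin

text \<open>
  The theorem is a degree count. The dual \<open>g\<^sup>*\<close> lives in degrees
  \<open>0, \<dots>, N - 1\<close>, so the generators \<open>s\<theta>\<close> of the Chevalley-Eilenberg algebra
  \<open>A\<close> live in degrees \<open>1, \<dots>, N\<close> and \<open>A\<close> vanishes in negative degrees. A derivation of degree
  below \<open>- N\<close> therefore sends every generator to a negative degree, that is to \<open>0\<close>, and by the
  Leibniz rule it is \<open>0\<close> (\<open>derivation_sym_dual_zero\<close>). Hence the weight \<open>1\<close> polyvectors
  \<open>s\<^sup>n\<^sup>+\<^sup>1D\<close> vanish below degree \<open>n + 1 - N\<close>, and those of weight \<open>m\<close> vanish below degree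
  \<open>m (n + 1 - N)\<close> (\<open>gens_above_tangent_CE\<close> and \<open>sym_piece_below\<close>). For \<open>m \<ge> 2\<close> and \<open>n > 2 N\<close>,
  \<open>m (n + 1 - N) \<ge> 2 (n + 1 - N) > n + 2\<close>, so a Poisson structure, which has degree \<open>n + 2\<close>, is \<open>0\<close>
  in each weight.

  The vanishing is always detected on single words: a word whose degree is too small for its weight
  contains a letter that represents a zero vector; such a letter lies in the ideal of relations, and
  with it the whole word (\<open>null_word_below\<close>).
\<close>

section \<open>Classes in a symmetric algebra\<close>

text \<open>
  Scaling is multiplication by a multiple of the empty word, so two-sided ideals are subspaces.
\<close>

lemma fscale_eq_fmult: "fscale c f = fmult (Poly_Mapping.single [] c) f"
proof (rule poly_mapping_eqI)
  fix w
  have "Poly_Mapping.lookup (fmult (Poly_Mapping.single [] c) f) w =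
      (\<Sum>v\<in>Poly_Mapping.keys f. c * Poly_Mapping.lookup f v when v = w)"
    by (cases "c = 0") (simp_all add: fmult_def lookup_sum lookup_single when_def)
  also have "\<dots> = Poly_Mapping.lookup (fscale c f) w"
    by (simp add: fscale_def Poly_Mapping.map.rep_eq when_def in_keys_iff)
  finally show "Poly_Mapping.lookup (fscale c f) w =
      Poly_Mapping.lookup (fmult (Poly_Mapping.single [] c) f) w"
    by simp
qed

lemma lookup_fscale: "Poly_Mapping.lookup (fscale c f) w = c * Poly_Mapping.lookup f w"
  by (simp add: fscale_def Poly_Mapping.map.rep_eq when_def)

lemma fscale_add: "fscale c (f + h) = fscale c f + fscale c h"
  by (rule poly_mapping_eqI) (simp add: lookup_fscale lookup_add distrib_left)

lemma fscale_0: "fscale 0 f = 0"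
  by (rule poly_mapping_eqI) (simp add: lookup_fscale)

lemma fscale_zero: "fscale c 0 = 0"
  by (rule poly_mapping_eqI) (simp add: lookup_fscale)

lemma fscale_fmono: "fscale c (fmono w) = Poly_Mapping.single w c"
  by (simp add: fscale_def fmono_def)

lemma fmult_fmono: "fmult (fmono u) (fmono v) = fmono (u @ v)"
  by (simp add: fmult_def fmono_def)

lemma fmono_in_carrier: "w \<in> lists (letters A M) \<Longrightarrow> fmono w \<in> carrier (free_alg A M)"
  by (simp add: free_alg_def fmono_def)

text \<open>
  The generated ideal is the intersection of all ideals containing the relations. As soon as one such
  ideal exists, its presence makes the free algebra a ring and puts the relations in the carrier, so
  the intersection is an ideal. If none exists, the intersection of the empty family is \<open>UNIV\<close>; then
  there is only one class and every identity between classes is trivial. Treating both cases gives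
  the calculus of classes below for arbitrary \<open>A\<close> and \<open>M\<close>.
\<close>

lemma sym_ideal_cases:
  "ideal (sym_ideal A M) (free_alg A M) \<or> sym_ideal A M = UNIV"
proof (cases "\<exists>J. ideal J (free_alg A M) \<and> sym_rels A M \<subseteq> J")
  case True
  then obtain J where J: "ideal J (free_alg A M)" "sym_rels A M \<subseteq> J"
    by blast
  then interpret ideal J "free_alg A M"
    by simp
  show ?thesis
    using genideal_ideal[of "sym_rels A M"] J(2) a_subset by (auto simp: sym_ideal_def)
next
  case False
  then show ?thesis
    by (auto simp: sym_ideal_def genideal_def)
qed

lemma sym_ideal_rel: "r \<in> sym_rels A M \<Longrightarrow> r \<in> sym_ideal A M"
  by (auto simp: sym_ideal_def genideal_def)

lemma sym_ideal_zero: "0 \<in> sym_ideal A M"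
  using sym_ideal_cases[of A M]
  by (auto dest!: ideal.axioms(1) additive_subgroup.zero_closed simp: free_alg_def)

lemma sym_ideal_add:
  "f \<in> sym_ideal A M \<Longrightarrow> h \<in> sym_ideal A M \<Longrightarrow> f + h \<in> sym_ideal A M"
  using sym_ideal_cases[of A M] additive_subgroup.a_closed[of "sym_ideal A M" "free_alg A M" f h]
  by (auto dest: ideal.axioms(1) simp: free_alg_def)

lemma sym_ideal_lmult:
  "f \<in> sym_ideal A M \<Longrightarrow> h \<in> carrier (free_alg A M) \<Longrightarrow> fmult h f \<in> sym_ideal A M"
  using sym_ideal_cases[of A M] ideal.I_l_closed[of "sym_ideal A M" "free_alg A M" f h]
  by (auto simp: free_alg_def)

lemma sym_ideal_rmult:
  "f \<in> sym_ideal A M \<Longrightarrow> h \<in> carrier (free_alg A M) \<Longrightarrow> fmult f h \<in> sym_ideal A M"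
  using sym_ideal_cases[of A M] ideal.I_r_closed[of "sym_ideal A M" "free_alg A M" f h]
  by (auto simp: free_alg_def)

lemma sym_ideal_fscale: "f \<in> sym_ideal A M \<Longrightarrow> fscale c f \<in> sym_ideal A M"
  unfolding fscale_eq_fmult by (erule sym_ideal_lmult) (simp add: free_alg_def)

lemma cls_UNIV: "sym_ideal A M = UNIV \<Longrightarrow> cls A M f = UNIV"
proof -
  assume "sym_ideal A M = UNIV"
  moreover have "h \<in> (\<Union>x. {x + f})" for h
    by (rule UN_I[of "h - f"]) simp_all
  ultimately show ?thesis
    by (auto simp: cls_def a_r_coset_def' free_alg_def)
qed

lemma cls_add:
  fixes A :: "('k::field, 'a, 'y) cdga_scheme" and M :: "('k, 'a, 'm, 'z) dgmod_scheme"
  assumes "f \<in> carrier (free_alg A M)" and "h \<in> carrier (free_alg A M)"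
  shows "cls A M (f + h) = ring.add (sym_ring A M) (cls A M f) (cls A M h)"
  using sym_ideal_cases[of A M]
proof
  assume "ideal (sym_ideal A M) (free_alg A M)"
  then show ?thesis
    using ideal.a_rcos_sum[OF _ assms] by (simp add: cls_def sym_ring_def FactRing_def free_alg_def)
next
  assume "sym_ideal A M = UNIV"
  moreover have "x \<in> (\<Union>y. \<Union>z. {y + z})" for x :: "('a, 'm, 'k) fsum"
    by (rule UN_I[of x], simp, rule UN_I[of 0]) simp_all
  ultimately show ?thesis
    by (auto simp: cls_UNIV sym_ring_def FactRing_def set_add_def' free_alg_def)
qed

lemma cls_mult:
  assumes "f \<in> carrier (free_alg A M)" and "h \<in> carrier (free_alg A M)"
  shows "cls A M (fmult f h) = monoid.mult (sym_ring A M) (cls A M f) (cls A M h)"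
  using sym_ideal_cases[of A M]
proof
  assume "ideal (sym_ideal A M) (free_alg A M)"
  then show ?thesis
    using ideal.rcoset_mult_add[OF _ assms]
    by (simp add: cls_def sym_ring_def FactRing_def free_alg_def)
next
  assume "sym_ideal A M = UNIV"
  then show ?thesis
    using cls_UNIV[of A M] by (simp add: cls_def sym_ring_def FactRing_def rcoset_mult_def)
qed

lemma cls_eq_if_mem:
  assumes "h \<in> cls A M f" and "f \<in> carrier (free_alg A M)"
  shows "cls A M h = cls A M f"
  using sym_ideal_cases[of A M]
proof
  assume I: "ideal (sym_ideal A M) (free_alg A M)"
  then interpret ideal "sym_ideal A M" "free_alg A M" .
  show ?thesis
    using a_repr_independence'[of h f] assms by (simp add: cls_def)
qed (simp add: cls_UNIV)

lemma mem_cls_self: "f \<in> cls A M f"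
  using sym_ideal_zero[of A M] by (force simp: cls_def a_r_coset_def' free_alg_def)

lemma cls_null: "f \<in> sym_ideal A M \<Longrightarrow> cls A M f = sym_ideal A M"
proof -
  assume f: "f \<in> sym_ideal A M"
  show ?thesis
    using sym_ideal_cases[of A M]
  proof
    assume "ideal (sym_ideal A M) (free_alg A M)"
    then interpret ideal "sym_ideal A M" "free_alg A M" .
    show ?thesis
      using a_rcos_const[OF f] by (simp add: cls_def)
  qed (simp add: cls_UNIV)
qed

text \<open>
  The relations span a subspace, so the union defining the induced scaling runs over equal cosets.
\<close>

lemma cls_fscale:
  assumes "f \<in> carrier (free_alg A M)"
  shows "lift_op A M (fscale c) (cls A M f) = cls A M (fscale c f)"
proof -
  have car: "fscale c f \<in> carrier (free_alg A M)"
    using assms by (auto simp: free_alg_def in_keys_iff lookup_fscale)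
  have "cls A M (fscale c h) = cls A M (fscale c f)" if "h \<in> cls A M f" for h
  proof -
    from that have "h \<in> (\<Union>r\<in>sym_ideal A M. {r + f})"
      by (simp add: cls_def a_r_coset_def' free_alg_def)
    then obtain r where r: "r \<in> sym_ideal A M" "h = r + f"
      by blast
    then have "fscale c h \<in> cls A M (fscale c f)"
      using sym_ideal_fscale[OF r(1), of c]
      by (auto simp: cls_def a_r_coset_def' free_alg_def fscale_add)
    then show ?thesis
      using cls_eq_if_mem car by blast
  qed
  then show ?thesis
    unfolding lift_op_def using mem_cls_self[of f A M] by blast
qed

lemma vzero_Sym: "vzero (Sym A M) = sym_ideal A M"
  by (simp add: Sym_def sym_ring_def FactRing_def)

lemma vscale_Sym_0:
  assumes "S \<in> piece (Sym A M) i"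
  shows "vscale (Sym A M) 0 S = vzero (Sym A M)"
proof -
  obtain f where "S = cls A M f" "f \<in> carrier (free_alg A M)"
    using assms by (auto simp: Sym_def)
  then have "vscale (Sym A M) 0 S = cls A M (fscale 0 f)"
    by (simp add: Sym_def cls_fscale)
  then show ?thesis
    by (simp add: fscale_0 cls_null sym_ideal_zero vzero_Sym)
qed


section \<open>Vanishing below a degree bound\<close>

text \<open>
  The scaling relation for the scalar \<open>0\<close> puts a letter with \<open>0 a = a\<close> in the ideal.
\<close>

lemma null_Coef:
  assumes "a \<in> piece A i" and "vscale A 0 a = a"
  shows "fmono [Coef i a] \<in> sym_ideal A M"
  using sym_ideal_rel[OF sym_rels.Coef_scale[OF assms(1), of 0 M]] assms(2) by (simp add: fscale_0)

lemma null_Gen: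
  assumes "x \<in> piece M i" and "vscale M 0 x = x"
  shows "fmono [Gen i x] \<in> sym_ideal A M"
  using sym_ideal_rel[OF sym_rels.Gen_scale[OF assms(1), of 0 A]] assms(2) by (simp add: fscale_0)

text \<open>
  Bounds below the degrees of the nonzero letters. That a vector \<open>x\<close> is zero is expressed by
  \<open>0 x = x\<close>, the form in which the scaling relation applies.
\<close>

definition gens_above ::
  "('k::field, 'a, 'y) cdga_scheme \<Rightarrow> ('k, 'a, 'm, 'z) dgmod_scheme \<Rightarrow> int \<Rightarrow> bool" where
  "gens_above A M b \<longleftrightarrow>
     (\<forall>i. \<forall>a\<in>piece A i. i < 0 \<longrightarrow> vscale A 0 a = a) \<and>
     (\<forall>i. \<forall>x\<in>piece M i. i < b \<longrightarrow> vscale M 0 x = x)"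

text \<open>
  The degree of a word is the sum of the degrees of its letters, and \<open>weight w * b\<close> is the sum of the
  lower bounds for them; if the first sum is smaller, some letter violates its bound.
\<close>

lemma null_word_below:
  assumes "gens_above A M b" and "w \<in> lists (letters A M)" and "lwdeg w < int (weight w) * b"
  shows "fmono w \<in> sym_ideal A M"
  using assms(2,3)
proof (induction w rule: list.induct)
  case Nil
  then show ?case
    by (simp add: lwdeg_def weight_def)
next
  case (Cons p w)
  show ?case
    \<comment> \<open>If the tail keeps its bound, it is the first letter that breaks its own.\<close>
  proof (cases "lwdeg w < int (weight w) * b")
    case True
    then have "fmult (fmono [p]) (fmono w) \<in> sym_ideal A M"
      using Cons by (intro sym_ideal_lmult fmono_in_carrier) auto
    then show ?thesis
      by (simp add: fmult_fmono)
  next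
    case False
    have p: "p \<in> letters A M"
      using Cons.prems by simp
    have low: "ldeg p < (if is_Gen p then b else 0)"
      using Cons.prems(2) False by (auto simp: lwdeg_def weight_def distrib_right)
    have "fmono [p] \<in> sym_ideal A M"
    proof (cases p)
      case (Coef i a)
      then have "a \<in> piece A i" "i < 0"
        using p low by (auto simp: letters_def)
      then show ?thesis
        unfolding Coef using assms(1) by (intro null_Coef) (auto simp: gens_above_def)
    next
      case (Gen i x)
      then have "x \<in> piece M i" "i < b"
        using p low by (auto simp: letters_def)
      then show ?thesis
        unfolding Gen using assms(1) by (intro null_Gen) (auto simp: gens_above_def)
    qed
    then have "fmult (fmono [p]) (fmono w) \<in> sym_ideal A M"
      using Cons by (intro sym_ideal_rmult fmono_in_carrier) auto
    then show ?thesis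
      by (simp add: fmult_fmono)
  qed
qed

text \<open>
  Formal sums all of whose words satisfy \<open>Q\<close> are built from the zero sum by adding multiples of
  such words; this carries facts about homogeneous words over to homogeneous elements.
\<close>

lemma fsum_induct [consumes 1, case_names zero add]:
  assumes words: "\<forall>w\<in>Poly_Mapping.keys f. Q w"
    and zero: "P 0"
    and add: "\<And>w c h. Q w \<Longrightarrow> \<forall>w\<in>Poly_Mapping.keys h. Q w \<Longrightarrow> P h \<Longrightarrow>
       P (fscale c (fmono w) + h)"
  shows "P f"
  using words
proof (induction f rule: update_induct)
  case const
  then show ?case
    by (simp add: zero)
next
  case (update f w c)
  have eq: "Poly_Mapping.update w c f = fscale c (fmono w) + f"
    using update.hyps
    by (intro poly_mapping_eqI)
      (auto simp: fscale_fmono lookup_update lookup_add lookup_single when_def in_keys_iff)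
  have "Poly_Mapping.keys (Poly_Mapping.update w c f) = insert w (Poly_Mapping.keys f)"
    using update.hyps by (auto simp: in_keys_iff lookup_update split: if_splits)
  then show ?case
    unfolding eq using add[of w f c] update.IH update.prems by (simp add: eq)
qed

lemma cls_zero_if_words_null:
  assumes "\<forall>w\<in>Poly_Mapping.keys f. fmono w \<in> sym_ideal A M"
  shows "cls A M f = vzero (Sym A M)"
proof -
  have "f \<in> sym_ideal A M"
    using assms
    by (induction rule: fsum_induct) (auto intro: sym_ideal_zero sym_ideal_add sym_ideal_fscale)
  then show ?thesis
    by (simp add: cls_null vzero_Sym)
qed

lemma cls_zero_if_words_below:
  assumes "gens_above A M b" and f: "f \<in> carrier (free_alg A M)"
    and "\<forall>w\<in>Poly_Mapping.keys f. lwdeg w < int (weight w) * b"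
  shows "cls A M f = vzero (Sym A M)"
proof (rule cls_zero_if_words_null, rule ballI)
  fix w assume w: "w \<in> Poly_Mapping.keys f"
  then have "w \<in> lists (letters A M)"
    using f by (auto simp only: free_alg_def partial_object.simps)
  then show "fmono w \<in> sym_ideal A M"
    using null_word_below[OF assms(1)] assms(3) w by blast
qed

lemma sym_piece_below:
  assumes "gens_above A M b" and "i < int m * b" and "S \<in> sym_piece A M m i"
  shows "S = vzero (Sym A M)"
proof -
  obtain f where "S = cls A M f" "f \<in> carrier (free_alg A M)"
    and "\<forall>w\<in>Poly_Mapping.keys f. lwdeg w = i \<and> weight w = m"
    using assms(3) unfolding sym_piece_def by blast
  then show ?thesis
    using cls_zero_if_words_below[OF assms(1), of f] assms(2) by simp
qed

lemma Sym_piece_negative: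
  assumes "gens_above A M 0" and "i < 0" and "S \<in> piece (Sym A M) i"
  shows "S = vzero (Sym A M)"
proof -
  obtain f where "S = cls A M f" "f \<in> carrier (free_alg A M)"
    and "\<forall>w\<in>Poly_Mapping.keys f. lwdeg w = i"
    using assms(3) unfolding Sym_def by auto
  then show ?thesis
    using cls_zero_if_words_below[OF assms(1), of f] assms(2) by simp
qed


section \<open>Derivations of negative degree\<close>

lemma hom_piece_closed:
  assumes "L \<in> hom_piece V W k" and "x \<in> piece V i"
  shows "L i x \<in> piece W (i + k)"
proof -
  have "L i \<in> piece V i \<rightarrow>\<^sub>E piece W (i + k)"
    using assms(1) by (simp add: hom_piece_def)
  then show ?thesis
    using assms(2) by (rule PiE_mem)
qed

lemma hom_piece_undefined:
  assumes "L \<in> hom_piece V W k" and "x \<notin> piece V i"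
  shows "L i x = undefined"
proof -
  have "L i \<in> piece V i \<rightarrow>\<^sub>E piece W (i + k)"
    using assms(1) by (simp add: hom_piece_def)
  then show ?thesis
    using assms(2) by (rule PiE_arb)
qed

lemma derivation_hom: "D \<in> derivations A k \<Longrightarrow> D \<in> hom_piece A A k"
  by (simp add: derivations_def)

text \<open>
  A derivation is determined by its values on the algebra generators, by the Leibniz rule and
  linearity. Here these values vanish because each letter either is zero already or is sent to a
  negative degree.
\<close>

lemma derivation_zero_if_letters:
  assumes D: "D \<in> derivations (Sym A M) k" and "k < 0" and A: "gens_above A M 0"
    and letters: "\<And>p. p \<in> letters A M \<Longrightarrow>
      ldeg p + k < 0 \<or> fmono [p] \<in> sym_ideal A M"
    and S: "S \<in> piece (Sym A M) i"
  shows "D i S = vzero (Sym A M)"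
proof -
  let ?S = "Sym A M"
  have mem: "cls A M f \<in> piece ?S j"
    if "\<forall>w\<in>Poly_Mapping.keys f. w \<in> lists (letters A M) \<and> lwdeg w = j" for f j
    using that by (auto simp: Sym_def free_alg_def)
  have wmem: "cls A M (fmono w) \<in> piece ?S (lwdeg w)" if "w \<in> lists (letters A M)" for w
    using that by (intro mem) (simp add: fmono_def)
  have z: "cls A M 0 = vzero ?S"
    by (simp add: cls_null sym_ideal_zero vzero_Sym)
  have zmult: "amult ?S (vzero ?S) (cls A M f) = vzero ?S"
      "amult ?S (cls A M f) (vzero ?S) = vzero ?S"
    if "f \<in> carrier (free_alg A M)" for f
    using cls_mult[of 0 A M f] cls_mult[of f A M 0] that
    by (simp_all add: free_alg_def z fmult_def) (simp_all add: Sym_def)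
  have zadd: "vadd ?S (vzero ?S) (vzero ?S) = vzero ?S"
    using cls_add[of 0 A M 0] z by (simp add: free_alg_def) (simp add: Sym_def)
  have zscale: "vscale ?S c (vzero ?S) = vzero ?S" for c
    using cls_fscale[of 0 A M c] z by (simp add: free_alg_def fscale_zero) (simp add: Sym_def)
  have Dz: "D j (vzero ?S) = vzero ?S" for j
  proof -
    have j: "vzero ?S \<in> piece ?S j"
      using mem[of 0 j] z by simp
    then have "D j (vscale ?S 0 (vzero ?S)) = vscale ?S 0 (D j (vzero ?S))"
      using D by (auto simp: derivations_def hom_piece_def)
    then show ?thesis
      using vscale_Sym_0[OF hom_piece_closed[OF derivation_hom[OF D] j]] by (simp add: zscale)
  qed
  have letter: "D (ldeg p) (cls A M (fmono [p])) = vzero ?S" if p: "p \<in> letters A M" for p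
    using letters[OF p]
  proof
    assume "ldeg p + k < 0"
    moreover have "cls A M (fmono [p]) \<in> piece ?S (ldeg p)"
      using wmem[of "[p]"] p by (simp add: lwdeg_def)
    ultimately show ?thesis
      using Sym_piece_negative[OF A] hom_piece_closed[OF derivation_hom[OF D]] by blast
  next
    assume "fmono [p] \<in> sym_ideal A M"
    then show ?thesis
      by (simp add: cls_null Dz flip: vzero_Sym)
  qed
  have word: "D (lwdeg w) (cls A M (fmono w)) = vzero ?S" if "w \<in> lists (letters A M)" for w
    using that
  proof (induction w rule: list.induct)
    case Nil
    have "cls A M (fmono []) \<in> piece ?S 0"
      using wmem[of "[]"] by (simp add: lwdeg_def)
    then have "D 0 (cls A M (fmono [])) \<in> piece ?S (0 + k)"
      by (rule hom_piece_closed[OF derivation_hom[OF D]])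
    then show ?case
      using \<open>k < 0\<close> Sym_piece_negative[OF A] by (simp add: lwdeg_def)
  next
    case (Cons p w)
    let ?a = "cls A M (fmono [p])" and ?b = "cls A M (fmono w)"
    have ab: "?a \<in> piece ?S (ldeg p)" "?b \<in> piece ?S (lwdeg w)"
      using wmem[of "[p]"] wmem[of w] Cons by (auto simp: lwdeg_def)
    have car: "fmono [p] \<in> carrier (free_alg A M)" "fmono w \<in> carrier (free_alg A M)"
      using Cons by (auto intro!: fmono_in_carrier)
    have "cls A M (fmono (p # w)) = amult ?S ?a ?b"
      using cls_mult[OF car] by (simp add: fmult_fmono Sym_def)
    then have "D (lwdeg (p # w)) (cls A M (fmono (p # w))) =
        vadd ?S (amult ?S (D (ldeg p) ?a) ?b)
          (vscale ?S (eps (k * ldeg p)) (amult ?S ?a (D (lwdeg w) ?b)))"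
      using D ab by (auto simp: derivations_def lwdeg_def)
    also have "\<dots> = vzero ?S"
      using Cons car letter by (simp add: zmult zscale zadd)
    finally show ?case .
  qed
  obtain f where f: "S = cls A M f"
    and "\<forall>w\<in>Poly_Mapping.keys f. w \<in> lists (letters A M) \<and> lwdeg w = i"
    using S by (auto simp: Sym_def free_alg_def)
  from this(2) have "D i (cls A M f) = vzero ?S"
  proof (induction rule: fsum_induct)
    case zero
    then show ?case
      by (simp add: z Dz)
  next
    case (add w c h)
    let ?w = "cls A M (fmono w)" and ?h = "cls A M h"
    have car: "fmono w \<in> carrier (free_alg A M)" "fscale c (fmono w) \<in> carrier (free_alg A M)"
        "h \<in> carrier (free_alg A M)"
      using add by (auto simp: free_alg_def fmono_def fscale_def)
    have cw: "cls A M (fscale c (fmono w)) = vscale ?S c ?w"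
      using cls_fscale[OF car(1)] by (simp add: Sym_def)
    have "vscale ?S c ?w \<in> piece ?S i"
      unfolding cw[symmetric] using add by (intro mem) (auto simp: fscale_fmono split: if_splits)
    moreover have "?w \<in> piece ?S i" "?h \<in> piece ?S i"
      using wmem[of w] mem[of h i] add by auto
    moreover have "cls A M (fscale c (fmono w) + h) = vadd ?S (vscale ?S c ?w) ?h"
      using cls_add[OF car(2,3)] cw by (simp add: Sym_def)
    ultimately have "D i (cls A M (fscale c (fmono w) + h)) =
        vadd ?S (vscale ?S c (D i ?w)) (D i ?h)"
      using D by (auto simp: derivations_def hom_piece_def)
    then show ?case
      using add word[of w] by (simp add: zscale zadd)
  qed
  then show ?thesis
    by (simp add: f)
qed


section \<open>The Chevalley-Eilenberg algebra of a Lie N-algebra\<close>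

text \<open>
  A functional \<open>\<theta>\<close> with \<open>s\<theta>\<close> of degree \<open>i\<close> can be nonzero only on degree \<open>1 - i\<close>, which lies in
  \<open>- N + 1, \<dots>, 0\<close> exactly for \<open>1 \<le> i \<le> N\<close>.
\<close>

lemma dual_shift_null:
  assumes g: "lie_N_algebra N g lb" and L: "L \<in> piece (dual_shift g) i"
    and i: "i < 1 \<or> int N < i"
  shows "vscale (dual_shift g) 0 L = L"
proof -
  have hom: "L \<in> hom_piece g (ground_cdga :: ('a, 'a) cdga) (i - 1)"
    using L by (simp add: dual_shift_def shift_def dual_def cochain.defs dgmod.defs hom_complex_def)
  have "L j x = 0" if x: "x \<in> piece g j" for j x
  proof (cases "j + (i - 1) = 0")
    case True
    then have "x = vzero g"
      using g i x unfolding lie_N_algebra_def by force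
    moreover have "module (ring_of_type_algebra :: 'a ring) (piece_module g j)"
      using g by (simp add: lie_N_algebra_def cochain_complex_def)
    then have "vscale g 0 x = vzero g"
      using module.smult_l_null[of "ring_of_type_algebra :: 'a ring" "piece_module g j" x] x
      by (simp add: piece_module_def ring_of_type_algebra_def)
    moreover have "L j (vscale g 0 x) = 0 * L j x"
      using hom x by (simp add: hom_piece_def ground_cdga_def)
    ultimately show ?thesis
      by simp
  next
    case False
    then show ?thesis
      using hom_piece_closed[OF hom x] by (simp add: ground_cdga_def)
  qed
  moreover have "L j x = undefined" if "x \<notin> piece g j" for j x
    using hom_piece_undefined[OF hom that] .
  ultimately show ?thesis
    by (auto simp: dual_shift_def shift_def dual_def cochain.defs dgmod.defs hom_complex_def
        ground_cdga_def restrict_def fun_eq_iff)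
qed

lemma gens_above_dual_shift:
  assumes "lie_N_algebra N g lb"
  shows "gens_above (ground_cdga :: ('k::field_char_0, 'k) cdga) (dual_shift g) 0"
  using dual_shift_null[OF assms] by (auto simp: gens_above_def ground_cdga_def)

lemma derivation_sym_dual_zero:
  assumes g: "lie_N_algebra N g lb" and D: "D \<in> derivations (sym_dual g) k"
    and k: "k < - int N" and S: "S \<in> piece (sym_dual g) i"
  shows "D i S = vzero (sym_dual g)"
  unfolding sym_dual_def
proof (rule derivation_zero_if_letters[where D = D and S = S and k = k and i = i])
  fix p assume p: "p \<in> letters (ground_cdga :: ('a, 'a) cdga) (dual_shift g)"
  show "ldeg p + k < 0 \<or> fmono [p] \<in> sym_ideal (ground_cdga :: ('a, 'a) cdga) (dual_shift g)"
  proof (cases p)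
    case (Coef j c)
    then have "j = 0 \<or> c = 0" "c \<in> piece (ground_cdga :: ('a, 'a) cdga) j"
      using p by (auto simp: letters_def ground_cdga_def split: if_splits)
    then show ?thesis
      using Coef k by (auto intro!: null_Coef simp: ground_cdga_def)
  next
    case (Gen j x)
    then show ?thesis
      using p k dual_shift_null[OF g, of x j]
      by (cases "int N < j") (auto intro!: null_Gen simp: letters_def)
  qed
qed (use D k S gens_above_dual_shift[OF g] in \<open>auto simp: sym_dual_def\<close>)

text \<open>
  The twist changes only the differential, so \<open>CE(g)\<close> and \<open>Sym(g\<^sup>*[-1])\<close> have the same pieces and the
  same derivations. A generator of degree \<open>i\<close> is \<open>s\<^sup>n\<^sup>+\<^sup>1D\<close> with \<open>D\<close> of degree \<open>i - n - 1\<close>, which is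
  below \<open>- N\<close> exactly for \<open>i < n + 1 - N\<close>.
\<close>

lemma gens_above_tangent_CE:
  assumes g: "lie_N_algebra N g lb"
  shows "gens_above (CE g lb) (shift (- n - 1) (tangent (CE g lb))) (n + 1 - int N)"
  unfolding gens_above_def
proof (intro conjI allI ballI impI)
  fix i a assume "a \<in> piece (CE g lb) i" and "i < 0"
  then show "vscale (CE g lb) 0 a = a"
    using Sym_piece_negative[OF gens_above_dual_shift[OF g]] vscale_Sym_0
    by (force simp: CE_def sym_dual_def)
next
  fix i D assume "D \<in> piece (shift (- n - 1) (tangent (CE g lb))) i" and i: "i < n + 1 - int N"
  then have D: "D \<in> derivations (sym_dual g) (i - n - 1)"
    by (simp add: shift_def tangent_def CE_def derivations_def hom_piece_def cochain.defs
        dgmod.defs hom_complex_def algebra_simps)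
  have "vscale (sym_dual g) 0 (D j x) = D j x" if "x \<in> piece (sym_dual g) j" for j x
    using derivation_sym_dual_zero[OF g D _ that] hom_piece_closed[OF derivation_hom[OF D] that] i vscale_Sym_0
    by (fastforce simp: sym_dual_def)
  moreover have "D j x = undefined" if "x \<notin> piece (sym_dual g) j" for j x
    using hom_piece_undefined[OF derivation_hom[OF D] that] .
  ultimately show "vscale (shift (- n - 1) (tangent (CE g lb))) 0 D = D"
    by (auto simp: shift_def tangent_def CE_def cochain.defs dgmod.defs hom_complex_def
        restrict_def fun_eq_iff)
qed

theorem lemma4p3:
  fixes N :: nat and n :: int
    and g :: "('k::field_char_0, 'v) cochain"
    and lb :: "nat \<Rightarrow> 'v word \<Rightarrow> 'v"
    and \<pi> :: "nat \<Rightarrow> (('v, 'k) ce, int \<Rightarrow> ('v, 'k) ce \<Rightarrow> ('v, 'k) ce, 'k) fsum set"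
  assumes "N \<ge> 1"
    and "lie_N_algebra N g lb"
    and "n > 2 * int N"
    and "shifted_poisson (CE g lb) n \<pi>"
  shows "\<pi> = completed_Pol_zero (CE g lb) n"
proof
  fix m
  show "\<pi> m = completed_Pol_zero (CE g lb) n m"
  proof (cases "m < 2")
    case True
    then show ?thesis
      using assms(4) by (simp add: shifted_poisson_def completed_Pol_zero_def)
  next
    case False
    have "n + 2 < 2 * (n + 1 - int N)"
      using assms(3) by simp
    also have "\<dots> \<le> int m * (n + 1 - int N)"
      using False assms(3) by (intro mult_right_mono) auto
    finally have "n + 2 < int m * (n + 1 - int N)" .
    moreover have "\<pi> m \<in> sym_piece (CE g lb) (shift (- n - 1) (tangent (CE g lb))) m (n + 2)"
      using assms(4) by (simp add: shifted_poisson_def completed_Pol_piece_def)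
    ultimately show ?thesis
      using sym_piece_below[OF gens_above_tangent_CE[OF assms(2)]]
      by (simp add: completed_Pol_zero_def Pol_def)
  qed
qed

end
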